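(* Let $q$ be a prime power and let $\mathbb{F}_q$ be the finite field of order $q$. There exists an orthomorphism polynomial of degree $q-3$ over $\mathbb{F}_q$ if and only if $q \notin \{2,3,5,8\}$.
   Context: A polynomial $f \in \mathbb{F}_q[x]$ is a permutation polynomial if the map $x \mapsto f(x)$ is a permutation of $\mathbb{F}_q$. A permutation polynomial $f \in \mathbb{F}_q[x]$ is an orthomorphism polynomial over $\mathbb{F}_q$ if the map $x \mapsto f(x)-x$ is also a permutation of $\mathbb{F}_q$. *)

theory Defs
  imports
    "HOL-Computational_Algebra.Computational_Algebra"
    "HOL-Number_Theory.Number_Theory"
begin

definition permutation_polynomial :: "'a :: finite_field poly \<Rightarrow> bool" where
  "permutation_polynomial f \<longleftrightarrow> bij (\<lambda>x. poly f x)"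

definition orthomorphism_polynomial :: "'a :: finite_field poly \<Rightarrow> bool" where
  "orthomorphism_polynomial f \<longleftrightarrow>
     permutation_polynomial f \<and> bij (\<lambda>x. poly f x - x)"

end

theory Submission
  imports Defs "HOL-Combinatorics.Permutations"
begin

text \<open>
  If \<open>f\<close> permutes the field, the coefficient of \<open>x ^ k\<close> in its reduced polynomial is
  \<open>- (\<Sum>c. f c * c ^ (q - 1 - k))\<close>. So we need an orthomorphism with \<open>\<Sum>c. f c * c = 0\<close>
  (automatic in odd characteristic) and \<open>\<Sum>c. f c * c ^ 2 \<noteq> 0\<close>. The second sum vanishes for the linear
  maps \<open>f x = a * x\<close>, but not after permuting their values on a suitable finite set. With
  \<open>l = a / (a - 1)\<close>, replacing \<open>a * x\<close> by \<open>a * \<sigma> x\<close> again gives an orthomorphism iff \<open>\<sigma>\<close> and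
  \<open>\<rho> x = x + l * (\<sigma> x - x)\<close> are both permutations. Such sets exist with 6 points in characteristic 2,
  with 11 points in characteristic 5, and with 7 Gaussian integers if \<open>-1\<close> is a square
  in another odd characteristic. If \<open>-1\<close> is a nonsquare, a map that is linear on the squares and on the
  nonsquares is changed at three points instead.

  For \<open>q = 8\<close>, a supposed orthomorphism polynomial of degree 5 can be normalised to
  \<open>x ^ 5 + b3 * x ^ 3 + b2 * x ^ 2 + b1 * x\<close>. Summing the cubes of its values and of the values of \<open>f x - x\<close>
  determines \<open>b3\<close> and \<open>b2\<close> in terms of \<open>b1\<close>, and then a nonzero \<open>x\<close> with \<open>f x \<in> {0, x}\<close>
  can be written down.
\<close>

hide_const (open) up_ring.coeff up_ring.monom

section \<open>Orthomorphisms as functions\<close>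

definition orthomorphism :: "('a :: finite_field \<Rightarrow> 'a) \<Rightarrow> bool" where
  "orthomorphism f \<longleftrightarrow> bij f \<and> bij (\<lambda>x. f x - x)"

lemma orthomorphism_polynomial_iff:
  "orthomorphism_polynomial f \<longleftrightarrow> orthomorphism (poly f)"
  by (simp add: orthomorphism_polynomial_def permutation_polynomial_def orthomorphism_def)

lemma sum_bij:
  fixes f :: "'a :: finite_field \<Rightarrow> 'a"
  assumes "bij f"
  shows "(\<Sum>x\<in>UNIV. g (f x)) = (\<Sum>x\<in>UNIV. g x)"
  using sum.reindex_bij_betw[OF assms] .

lemma bij_finite_iff_inj:
  fixes f :: "'a :: finite \<Rightarrow> 'a"
  shows "bij f \<longleftrightarrow> inj f"
  using finite_UNIV_inj_surj[of f] by (auto simp: bij_def)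

section \<open>Power sums over a finite field\<close>

lemma power_card_minus_one:
  fixes x :: "'a :: finite_field"
  assumes "x \<noteq> 0"
  shows "x ^ (card (UNIV :: 'a set) - 1) = 1"
proof -
  have "card (UNIV :: 'a set) > 0" by (simp add: finite_UNIV_card_ge_0)
  then have "x * x ^ (card (UNIV :: 'a set) - 1) = x * 1"
    using finite_field_power_card_eq_same[of x] by (metis Suc_diff_1 mult.right_neutral power_Suc)
  then show ?thesis using assms by simp
qed

lemma ex_poly_nonzero:
  fixes p :: "'a :: {comm_ring_1, ring_no_zero_divisors, finite} poly"
  assumes "p \<noteq> 0" "degree p < card (UNIV :: 'a set)"
  shows "\<exists>x. poly p x \<noteq> 0"
proof (rule ccontr)
  assume "\<not> ?thesis"
  then have "{x. poly p x = 0} = UNIV" by auto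
  then show False using card_poly_roots_bound[OF assms(1)] assms(2) by simp
qed

text \<open>The polynomial \<open>x ^ (k + 1) - x\<close> has degree below the field order, so it is
  nonzero somewhere; its factor \<open>x\<close> makes that point nonzero.\<close>

lemma ex_power_neq_1:
  assumes "0 < k" "k < card (UNIV :: 'a :: finite_field set) - 1"
  shows "\<exists>x :: 'a. x \<noteq> 0 \<and> x ^ k \<noteq> 1"
proof -
  define p :: "'a poly" where "p = monom 1 (Suc k) - monom 1 1"
  have "coeff p (Suc k) = 1" using assms by (simp add: p_def)
  then have "p \<noteq> 0" by auto
  moreover have "degree p \<le> Suc k"
    unfolding p_def by (rule degree_diff_le) (auto intro: order.trans[OF degree_monom_le])
  ultimately obtain x where "poly p x \<noteq> 0"
    using ex_poly_nonzero[of p] assms by fastforce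
  then show ?thesis by (auto simp: p_def poly_monom)
qed

text \<open>For \<open>k > 0\<close>, multiplication by some \<open>g\<close> with
  \<open>g ^ k \<noteq> 1\<close> permutes the field and scales the sum by \<open>g ^ k\<close>. For
  \<open>k = 0\<close> the sum is the field order, which is 0 in the field.\<close>

lemma sum_power_eq_0:
  assumes "k < card (UNIV :: 'a :: finite_field set) - 1"
  shows "(\<Sum>x\<in>(UNIV :: 'a set). x ^ k) = 0"
proof (cases "k = 0")
  case True
  then show ?thesis using CHAR_dvd_CARD[where 'a='a] by (simp add: of_nat_eq_0_iff_char_dvd)
next
  case False
  then obtain g :: 'a where g: "g \<noteq> 0" "g ^ k \<noteq> 1" using ex_power_neq_1 assms by blast
  have "bij (\<lambda>x. g * x)"
    unfolding bij_finite_iff_inj using g by (auto simp: inj_def)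
  from sum_bij[OF this, of "\<lambda>x. x ^ k"]
  have "g ^ k * (\<Sum>x\<in>UNIV. x ^ k) = (\<Sum>x\<in>UNIV. x ^ k)"
    by (simp add: power_mult_distrib sum_distrib_left)
  then show ?thesis using g by simp
qed

lemma sum_power_card_minus_one:
  assumes "card (UNIV :: 'a :: finite_field set) > 1"
  shows "(\<Sum>x\<in>(UNIV :: 'a set). x ^ (card (UNIV :: 'a set) - 1)) = - 1"
proof -
  let ?q = "card (UNIV :: 'a set)"
  have "(\<Sum>x\<in>(UNIV :: 'a set). x ^ (?q - 1)) = (\<Sum>x\<in>UNIV - {0}. x ^ (?q - 1))"
    using assms by (intro sum.mono_neutral_right) (auto simp: power_0_left)
  also have "\<dots> = (\<Sum>x\<in>UNIV - {0 :: 'a}. 1)"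
    by (intro sum.cong refl power_card_minus_one) auto
  also have "\<dots> = of_nat ?q - 1" using assms by (simp add: card_Diff_singleton of_nat_diff)
  also have "\<dots> = - 1" using CHAR_dvd_CARD[where 'a='a] by (simp add: of_nat_eq_0_iff_char_dvd)
  finally show ?thesis .
qed

section \<open>Moments of an orthomorphism and the degree of its polynomial\<close>

text \<open>In the expanded sum of \<open>(f x - x) ^ 2\<close>, the sums of squares run over
  rearrangements of the field and vanish, which leaves twice the mixed sum.\<close>

lemma sum_mult_orthomorphism:
  fixes f :: "'a :: finite_field \<Rightarrow> 'a"
  assumes f: "orthomorphism f" and q: "card (UNIV :: 'a set) > 3" and two: "(2 :: 'a) \<noteq> 0"
  shows "(\<Sum>x\<in>UNIV. f x * x) = 0"
proof -
  have sq: "(\<Sum>x\<in>UNIV. x ^ 2) = (0 :: 'a)" using q by (intro sum_power_eq_0) auto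
  have "0 = (\<Sum>x\<in>UNIV. (f x - x) ^ 2)"
    using sum_bij[of "\<lambda>x. f x - x" "\<lambda>x. x ^ 2"] f sq by (simp add: orthomorphism_def)
  also have "\<dots> = (\<Sum>x\<in>UNIV. f x ^ 2) + (\<Sum>x\<in>UNIV. x ^ 2) - 2 * (\<Sum>x\<in>UNIV. f x * x)"
    by (simp add: power2_diff sum.distrib sum_subtractf sum_distrib_left mult.assoc)
  also have "(\<Sum>x\<in>UNIV. f x ^ 2) = 0"
    using sum_bij[of f "\<lambda>x. x ^ 2"] f sq by (simp add: orthomorphism_def)
  finally show ?thesis using two sq by simp
qed

lemma ex_orthomorphism_polynomial:
  fixes f :: "'a :: finite_field \<Rightarrow> 'a"
  assumes f: "orthomorphism f" and q: "card (UNIV :: 'a set) > 3"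
    and s1: "(\<Sum>x\<in>UNIV. f x * x) = 0" and s2: "(\<Sum>x\<in>UNIV. f x * x ^ 2) \<noteq> 0"
  shows "\<exists>p :: 'a poly. orthomorphism_polynomial p \<and> degree p = card (UNIV :: 'a set) - 3"
proof -
  define q where "q = card (UNIV :: 'a set)"
  have q3: "q > 3" using q by (simp add: q_def)
  define c where "c k = - (\<Sum>x\<in>UNIV. f x * x ^ (q - 1 - k))" for k
  define p where "p = (\<Sum>k<q. monom (c k) k)"
  have coeff: "coeff p k = (if k < q then c k else 0)" for k
    by (simp add: p_def coeff_sum if_distrib cong: if_cong)
  have s0: "(\<Sum>x\<in>UNIV. f x) = 0"
    using sum_bij[of f "\<lambda>x. x"] f sum_power_eq_0[of 1, where 'a='a] q 
    by (simp add: orthomorphism_def)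
  \<comment> \<open>Off the diagonal this is \<open>(y ^ q - x ^ q) / (y - x)\<close>, where
    \<open>q\<close>-th powers are trivial; on it, \<open>q\<close> equal terms add up to 0.\<close>
  have geo: "(\<Sum>k<q. x ^ (q - 1 - k) * y ^ k) = (if x = y then 0 else 1)" for x y :: 'a
  proof (cases "x = y")
    case True
    have "(\<Sum>k<q. x ^ (q - 1 - k) * y ^ k) = (\<Sum>k<q. x ^ (q - 1))"
      using True by (intro sum.cong) (auto simp flip: power_add)
    also have "\<dots> = 0"
      using CHAR_dvd_CARD[where 'a='a] by (simp add: q_def of_nat_eq_0_iff_char_dvd)
    finally show ?thesis using True by simp
  next
    case False
    have "(y - x) * (\<Sum>k<q. x ^ (q - Suc k) * y ^ k) = y ^ q - x ^ q"
      by (simp add: power_diff_sumr2 mult.commute)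
    also have "\<dots> = y - x" by (simp add: q_def finite_field_power_card_eq_same)
    finally show ?thesis using False by simp
  qed
  have "poly p y = f y" for y
  proof -
    have "poly p y = (\<Sum>k<q. c k * y ^ k)" by (simp add: p_def poly_sum poly_monom)
    also have "\<dots> = - (\<Sum>k<q. \<Sum>x\<in>UNIV. f x * (x ^ (q - 1 - k) * y ^ k))"
      by (simp add: c_def sum_negf sum_distrib_right mult.assoc)
    also have "\<dots> = - (\<Sum>x\<in>UNIV. f x * (\<Sum>k<q. x ^ (q - 1 - k) * y ^ k))"
      by (subst sum.swap) (simp add: sum_distrib_left)
    also have "\<dots> = - (\<Sum>x\<in>UNIV. f x - (if x = y then f x else 0))"
      by (intro arg_cong[of _ _ uminus] sum.cong) (simp_all only: geo, auto)
    also have "\<dots> = f y" by (simp add: sum_subtractf s0)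
    finally show ?thesis .
  qed
  then have "poly p = f" by (rule ext)
  then have "orthomorphism_polynomial p" using f by (simp add: orthomorphism_polynomial_iff)
  moreover have "degree p = q - 3"
  proof (rule antisym)
    show "degree p \<le> q - 3"
    proof (intro degree_le allI impI)
      fix k assume k: "k > q - 3"
      consider "k \<ge> q" | "k = q - 1" | "k = q - 2" using k by linarith
      then show "coeff p k = 0"
        using q3 s0 s1 by cases (simp_all add: coeff c_def Suc_diff_Suc numeral_2_eq_2)
    qed
    have "q - Suc (q - 3) = 2" using q3 by simp
    then have "coeff p (q - 3) \<noteq> 0" using q3 s2 by (simp add: coeff c_def)
    then show "q - 3 \<le> degree p" by (rule le_degree)
  qed
  ultimately show ?thesis by (auto simp: q_def)
qed

lemma char_2_simps:
  fixes x y :: "'a :: comm_ring_1"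
  assumes two: "(2 :: 'a) = 0"
  shows "x + x = 0" "x + (x + y) = y" "- x = x" "x - y = x + y" "(x + y) ^ 2 = x ^ 2 + y ^ 2"
proof -
  show *: "x + x = 0" for x :: 'a using two by (metis mult_2 mult_zero_left)
  show "x + (x + y) = y" using *[of x] by (simp flip: add.assoc)
  show neg: "- x = x" for x :: 'a using *[of x] by (simp add: add_eq_0_iff)
  show "x - y = x + y" using neg[of y] by (metis diff_conv_add_uminus)
  show "(x + y) ^ 2 = x ^ 2 + y ^ 2" by (simp add: power2_sum two)
qed

section \<open>Modifying linear maps\<close>

text \<open>
  An entry \<open>(x, y, z)\<close> of \<open>T\<close> records \<open>y = \<sigma> x\<close> and \<open>z = \<rho> x\<close>.
\<close>
lemma ex_of_trade:
  fixes l :: "'a :: finite_field" and T :: "('a \<times> 'a \<times> 'a) list"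
  assumes q: "card (UNIV :: 'a set) > 4" and l: "l \<noteq> 0" "l \<noteq> 1"
    and T: "distinct (map fst T)"
      "set (map (\<lambda>(x, y, z). y) T) = set (map fst T)"
      "set (map (\<lambda>(x, y, z). z) T) = set (map fst T)"
    and eq: "\<forall>(x, y, z)\<in>set T. l * (y - x) = z - x"
    and s1: "(2 :: 'a) \<noteq> 0 \<or> (\<Sum>(x, y, z)\<leftarrow>T. (y - x) * x) = 0"
    and s2: "(\<Sum>(x, y, z)\<leftarrow>T. (y - x) * x ^ 2) \<noteq> 0"
  shows "\<exists>p :: 'a poly. orthomorphism_polynomial p \<and> degree p = card (UNIV :: 'a set) - 3"
proof -
  define S R where "S = map (\<lambda>(x, y, z). (x, y)) T" and "R = map (\<lambda>(x, y, z). (x, z)) T"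
  have fst: "map fst S = map fst T" "map fst R = map fst T"
    and snd: "map snd S = map (\<lambda>(x, y, z). y) T" "map snd R = map (\<lambda>(x, y, z). z) T"
    by (auto simp: S_def R_def)
  define \<sigma> \<rho> where "\<sigma> = permutation_of_list S" and "\<rho> = permutation_of_list R"
  \<comment> \<open>All three columns have the same length and the same set, so distinctness passes
    from the first to the others.\<close>
  have "distinct (map (\<lambda>(x, y, z). y) T)" "distinct (map (\<lambda>(x, y, z). z) T)"
    using T by (metis card_distinct distinct_card length_map)+
  then have "list_permutes S UNIV" "list_permutes R UNIV"
    unfolding list_permutes_def fst snd using T fst snd by (metis list.set_map subset_UNIV)+
  then have bij: "bij \<sigma>" "bij \<rho>"
    unfolding \<sigma>_def \<rho>_def by (metis permutation_of_list_permutes permutes_bij)+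
  have \<sigma>\<rho>: "\<sigma> x = y \<and> \<rho> x = z" if "(x, y, z) \<in> set T" for x y z
    unfolding \<sigma>_def \<rho>_def using T(1) that
    by (intro conjI permutation_of_list_unique') (auto simp: fst, auto simp: S_def R_def image_iff intro: bexI[of _ "(x, y, z)"])
  have outside: "\<sigma> x = x" "\<rho> x = x" if "x \<notin> fst ` set T" for x
    unfolding \<sigma>_def \<rho>_def using that fst
    by (metis list.set_map permutation_of_list_id)+
  have step: "l * (\<sigma> x - x) = \<rho> x - x" for x
  proof (cases "x \<in> fst ` set T")
    case True
    then obtain y z where "(x, y, z) \<in> set T" by auto
    then show ?thesis using \<sigma>\<rho> eq by fastforce
  qed (simp add: outside)
  \<comment> \<open>This inverts \<open>l = a / (a - 1)\<close>; it gives
    \<open>a / l = 1 / (l - 1)\<close>, the factor in \<open>diff\<close>.\<close>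
  define a where "a = l / (l - 1)"
  define f where "f x = a * \<sigma> x" for x
  have a: "a \<noteq> 0" using l by (simp add: a_def)
  have diff: "f x - x = (a / l) * \<rho> x" for x
  proof -
    have "(l - 1) * (f x - x) = l * \<sigma> x - (l - 1) * x"
      using l by (simp add: f_def a_def right_diff_distrib)
    also have "\<dots> = \<rho> x" using step[of x] by (simp add: algebra_simps)
    finally have "f x - x = \<rho> x / (l - 1)" using l by (simp add: nonzero_eq_divide_eq mult.commute)
    then show ?thesis using l by (simp add: a_def)
  qed
  have inj_mult: "inj (\<lambda>x. c * \<tau> x)" if "c \<noteq> 0" "bij \<tau>" for c and \<tau> :: "'a \<Rightarrow> 'a"
    using that by (simp add: bij_def inj_def)
  have "inj f" unfolding f_def using bij a by (intro inj_mult)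
  moreover have "inj (\<lambda>x. f x - x)" unfolding diff using bij a l by (intro inj_mult) simp_all
  ultimately have orth: "orthomorphism f" by (simp add: orthomorphism_def bij_finite_iff_inj)
  \<comment> \<open>Writing \<open>\<sigma> x\<close> as \<open>x + (\<sigma> x - x)\<close> splits
    off a vanishing power sum, so only the points listed in \<open>T\<close> contribute.\<close>
  have sum: "(\<Sum>x\<in>UNIV. f x * x ^ k) = a * (\<Sum>(x, y, z)\<leftarrow>T. (y - x) * x ^ k)"
    if "Suc k < card (UNIV :: 'a set) - 1" for k
  proof -
    have "(\<Sum>x\<in>UNIV. f x * x ^ k) = a * ((\<Sum>x\<in>UNIV. (\<sigma> x - x) * x ^ k) + (\<Sum>x\<in>UNIV. x ^ Suc k))"
      by (simp add: f_def sum_distrib_left sum.distrib[symmetric] algebra_simps)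
    also have "(\<Sum>x\<in>UNIV. x ^ Suc k) = (0 :: 'a)" using that by (rule sum_power_eq_0)
    also have "(\<Sum>x\<in>UNIV. (\<sigma> x - x) * x ^ k) = (\<Sum>x\<in>set (map fst T). (\<sigma> x - x) * x ^ k)"
      by (intro sum.mono_neutral_right) (auto simp: outside)
    also have "\<dots> = (\<Sum>x\<leftarrow>map fst T. (\<sigma> x - x) * x ^ k)"
      using T(1) by (simp add: sum_list_distinct_conv_sum_set del: map_map)
    also have "\<dots> = (\<Sum>(x, y, z)\<leftarrow>T. (y - x) * x ^ k)"
      unfolding map_map by (intro arg_cong[of _ _ sum_list] map_cong) (auto dest: \<sigma>\<rho>)
    finally show ?thesis by simp
  qed
  have "(\<Sum>x\<in>UNIV. f x * x) = 0"
  proof (cases "(2 :: 'a) = 0")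
    case True
    then show ?thesis using s1 sum[of 1] q by simp
  next
    case False
    then show ?thesis using q by (intro sum_mult_orthomorphism[OF orth]) simp_all
  qed
  moreover have "(\<Sum>x\<in>UNIV. f x * x ^ 2) \<noteq> 0" using sum[of 2] q s2 a by simp
  ultimately show ?thesis using q by (intro ex_orthomorphism_polynomial[OF orth]) simp_all
qed

section \<open>Explicit finite sets for the modification, by characteristic\<close>

lemma ex_of_char_2:
  assumes q: "card (UNIV :: 'a :: finite_field set) > 10" and two: "(2 :: 'a) = 0"
  shows "\<exists>p :: 'a poly. orthomorphism_polynomial p \<and> degree p = card (UNIV :: 'a set) - 3"
proof -
  note dbl = char_2_simps(1)[OF two]
  note dbl' = char_2_simps(2)[OF two]
  note neg = char_2_simps(3)[OF two]
  note dif = char_2_simps(4)[OF two]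
  note char2 = dbl dbl' neg dif two
  \<comment> \<open>All nonzero polynomials of degree at most 3 over the prime field are products of these factors.\<close>
  define p :: "'a poly" where
    "p = [:0, 1:] * [:1, 1:] * [:1, 1, 1:] * [:1, 1, 0, 1:] * [:1, 0, 1, 1:]"
  have "p \<noteq> 0" by (simp add: p_def)
  moreover have "degree p \<le> 10"
    by (simp add: p_def degree_mult_eq del: mult_pCons_left mult_pCons_right)
  ultimately obtain l where "poly p l \<noteq> 0" using ex_poly_nonzero[of p] q by auto
  then have "l \<noteq> 0 \<and> 1 + l \<noteq> 0 \<and> 1 + l * (1 + l) \<noteq> 0 \<and> 1 + l * (1 + l * l) \<noteq> 0 \<and> 1 + l * (l * (1 + l)) \<noteq> 0"
    by (simp add: p_def del: mult_pCons_left mult_pCons_right)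
  then have l: "l \<noteq> 0" "1 + l \<noteq> 0" "1 + l + l * l \<noteq> 0"
      "1 + l + l * l * l \<noteq> 0" "1 + l * l + l * l * l \<noteq> 0"
    by (simp_all add: algebra_simps)
  have l1: "l \<noteq> 1" using l(2) two by auto
  show ?thesis
  proof (rule ex_of_trade[OF _ l(1) l1])
    show "card (UNIV :: 'a set) > 4" using q by simp
    let ?T = "[(0, l, l * l), (l * l, 1 + l + l * l, l), (l, l * l, l + l * l + l * l * l),
      (l + l * l + l * l * l, 1 + l * l * l, 0), (1 + l * l * l, l + l * l + l * l * l, 1 + l + l * l),
      (1 + l + l * l, 0, 1 + l * l * l)]"
    \<comment> \<open>Differences are sums in characteristic 2; each of the 15 below is a product of
      factors that are nonzero by the choice of \<open>l\<close>.\<close>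
    have neq: "x \<noteq> y" if "x + y = z" "z \<noteq> 0" for x y z :: 'a using that dbl by auto
    have neq01: "0 \<noteq> l * l"
      by (rule neq[of _ _ "l * l"]) (simp add: algebra_simps char2, simp add: l)
    have neq02: "0 \<noteq> l"
      by (rule neq[of _ _ "l"]) (simp add: algebra_simps char2, simp add: l)
    have neq03: "0 \<noteq> l + l * l + l * l * l"
      by (rule neq[of _ _ "l * (1 + l + l * l)"]) (simp add: algebra_simps char2, simp add: l)
    have neq04: "0 \<noteq> 1 + l * l * l"
      by (rule neq[of _ _ "(1 + l) * (1 + l + l * l)"]) (simp add: algebra_simps char2, simp add: l)
    have neq05: "0 \<noteq> 1 + l + l * l"
      by (rule neq[of _ _ "(1 + l + l * l)"]) (simp add: algebra_simps char2, simp add: l)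
    have neq12: "l * l \<noteq> l"
      by (rule neq[of _ _ "l * (1 + l)"]) (simp add: algebra_simps char2, simp add: l)
    have neq13: "l * l \<noteq> l + l * l + l * l * l"
      by (rule neq[of _ _ "l * ((1 + l) * (1 + l))"]) (simp add: algebra_simps char2, simp add: l)
    have neq14: "l * l \<noteq> 1 + l * l * l"
      by (rule neq[of _ _ "1 + l * l + l * l * l"]) (simp add: algebra_simps char2, simp add: l)
    have neq15: "l * l \<noteq> 1 + l + l * l"
      by (rule neq[of _ _ "(1 + l)"]) (simp add: algebra_simps char2, simp add: l)
    have neq23: "l \<noteq> l + l * l + l * l * l"
      by (rule neq[of _ _ "l * (l * (1 + l))"]) (simp add: algebra_simps char2, simp add: l)
    have neq24: "l \<noteq> 1 + l * l * l"
      by (rule neq[of _ _ "1 + l + l * l * l"]) (simp add: algebra_simps char2, simp add: l)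
    have neq25: "l \<noteq> 1 + l + l * l"
      by (rule neq[of _ _ "(1 + l) * (1 + l)"]) (simp add: algebra_simps char2, simp add: l)
    have neq34: "l + l * l + l * l * l \<noteq> 1 + l * l * l"
      by (rule neq[of _ _ "(1 + l + l * l)"]) (simp add: algebra_simps char2, simp add: l)
    have neq35: "l + l * l + l * l * l \<noteq> 1 + l + l * l"
      by (rule neq[of _ _ "(1 + l) * (1 + l + l * l)"]) (simp add: algebra_simps char2, simp add: l)
    have neq45: "1 + l * l * l \<noteq> 1 + l + l * l"
      by (rule neq[of _ _ "l * (1 + l + l * l)"]) (simp add: algebra_simps char2, simp add: l)
    show "distinct (map fst ?T)"
      using neq01 neq02 neq03 neq04 neq05 neq12 neq13 neq14 neq15 neq23 neq24 neq25 neq34 neq35 neq45 by simp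
    show "set (map (\<lambda>(x, y, z). y) ?T) = set (map fst ?T)" by auto
    show "set (map (\<lambda>(x, y, z). z) ?T) = set (map fst ?T)" by auto
    show "\<forall>(x, y, z)\<in>set ?T. l * (y - x) = z - x"
      by (simp add: algebra_simps char2)
    \<comment> \<open>The last three entries share the displacement \<open>1 + l + l * l\<close> and
      their points add up to 0, so they cancel here and, squaring being additive, also in the next
      sum.\<close>
    have "(\<Sum>(x, y, z)\<leftarrow>?T. (y - x) * x) = 0"
      by (simp add: algebra_simps char2)
    then show "(2 :: 'a) \<noteq> 0 \<or> (\<Sum>(x, y, z)\<leftarrow>?T. (y - x) * x) = 0" ..
    have "(\<Sum>(x, y, z)\<leftarrow>?T. (y - x) * x ^ 2) = l * l * l * ((1 + l) * (1 + l))"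
      by (simp add: algebra_simps char2 power2_eq_square)
    then show "(\<Sum>(x, y, z)\<leftarrow>?T. (y - x) * x ^ 2) \<noteq> 0"
      using l by (simp only: mult_eq_0_iff) simp
  qed
qed

text \<open>For \<open>l = i\<close>, each entry is a right isosceles triangle: \<open>z - x\<close>
  is \<open>y - x\<close> after a quarter turn. The points are seven of the nine in a 3 by 3 grid of
  Gaussian integers.\<close>

lemma ex_of_sqrt_minus_one:
  fixes i :: "'a :: finite_field"
  assumes q: "card (UNIV :: 'a set) > 4"
    and i: "i * i = - 1" and two: "(2 :: 'a) \<noteq> 0" and five: "(5 :: 'a) \<noteq> 0"
  shows "\<exists>p :: 'a poly. orthomorphism_polynomial p \<and> degree p = card (UNIV :: 'a set) - 3"
proof -
  define G where "G a b = of_int a + of_int b * i" for a b :: int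
  \<comment> \<open>A coincidence makes the norm \<open>(a - c) ^ 2 + (b - d) ^ 2\<close> vanish in
    the field. The nonzero norms in this range are 1, 2, 4, 5 and 8, whence the conditions on 2 and
    5.\<close>
  have G_eq: "G a b = G c d \<longleftrightarrow> a = c \<and> b = d" if "a - c \<in> {-2..2}" "b - d \<in> {-2..2}" for a b c d
  proof
    assume "G a b = G c d"
    then have *: "of_int (a - c) = - of_int (b - d) * i" by (simp add: G_def algebra_simps)
    have "of_int (a - c) * of_int (a - c) = (of_int (b - d) * of_int (b - d)) * (i * i)"
      unfolding * by (simp add: mult_ac del: of_int_diff)
    then have "of_int ((a - c) ^ 2 + (b - d) ^ 2) = (0 :: 'a)"
      unfolding i by (simp add: power2_eq_square)
    moreover have "a - c \<in> {-2, -1, 0, 1, 2}" "b - d \<in> {-2, -1, 0, 1, 2}" using that by auto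
    moreover have "(4 :: 'a) = 2 * 2" "(8 :: 'a) = 2 * 2 * 2" by simp_all
    then have "(4 :: 'a) \<noteq> 0" "(8 :: 'a) \<noteq> 0" using two by (metis mult_eq_0_iff)+
    ultimately have "a - c = 0 \<and> b - d = 0"
      using two five by (elim insertE) auto
    then show "a = c \<and> b = d" by simp
  qed auto
  have "i \<noteq> 0" "i \<noteq> 1" using i two by (auto simp: eq_neg_iff_add_eq_0)
  have i2: "i * (i * x) = - x" for x using i by (metis minus_mult_left mult.assoc mult_1)
  show ?thesis
  proof (rule ex_of_trade[OF q \<open>i \<noteq> 0\<close> \<open>i \<noteq> 1\<close>])
    let ?T = "[(G 0 0, G 2 0, G 0 2), (G 0 1, G 0 0, G 1 1), (G 0 2, G 0 1, G 1 2),
      (G 1 1, G 1 2, G 0 1), (G 1 2, G 1 1, G 2 2), (G 2 0, G 2 2, G 0 0), (G 2 2, G 0 2, G 2 0)]"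
    show "distinct (map fst ?T)" by (simp add: G_eq)
    show "set (map (\<lambda>(x, y, z). y) ?T) = set (map fst ?T)" by auto
    show "set (map (\<lambda>(x, y, z). z) ?T) = set (map fst ?T)" by auto
    show "\<forall>(x, y, z)\<in>set ?T. i * (y - x) = z - x"
      by (simp add: G_def algebra_simps i i2)
    show "(2 :: 'a) \<noteq> 0 \<or> (\<Sum>(x, y, z)\<leftarrow>?T. (y - x) * x) = 0" using two ..
    have "(\<Sum>(x, y, z)\<leftarrow>?T. (y - x) * x ^ 2) = 2"
      by (simp add: G_def algebra_simps power2_eq_square i i2)
    then show "(\<Sum>(x, y, z)\<leftarrow>?T. (y - x) * x ^ 2) \<noteq> 0" using two by (simp only:) simp
  qed
qed

text \<open>Here the square roots of -1 lie in the prime field, so Gaussian integers collide. With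
  \<open>l\<close> outside the prime field the 25 points \<open>a + b * l\<close> are distinct;
  \<open>\<sigma>\<close> changes only the first coordinate, and \<open>\<rho>\<close> changes the
  second by the same amount modulo 5.\<close>

lemma ex_of_char_5:
  assumes q: "card (UNIV :: 'a :: finite_field set) > 5" and five: "(5 :: 'a) = 0"
  shows "\<exists>p :: 'a poly. orthomorphism_polynomial p \<and> degree p = card (UNIV :: 'a set) - 3"
proof -
  have "card {0, 1, 2, 3, 4 :: 'a} \<le> 5" by (simp add: card_insert_if)
  then obtain l :: 'a where l: "l \<notin> {0, 1, 2, 3, 4}"
    using q by (metis UNIV_I not_less subsetI card_mono finite.intros order.strict_trans2 subset_antisym)
  have mod: "of_int k = (of_int (k mod 5) :: 'a)" for k
  proof -
    have "of_int k = (of_int (5 * (k div 5) + k mod 5) :: 'a)" by simp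
    also have "\<dots> = of_int (k mod 5)" unfolding of_int_add of_int_mult using five by simp
    finally show ?thesis .
  qed
  have two: "(2 :: 'a) \<noteq> 0"
  proof
    assume "(2 :: 'a) = 0"
    moreover have "(5 :: 'a) = 2 * 2 + 1" by simp
    ultimately show False using five by (simp only:) simp
  qed
  define G where "G a b = of_int a + of_int b * l" for a b :: int
  have G_eq: "G a b = G c d \<longleftrightarrow> a = c \<and> b = d"
    if "a \<in> {0..4}" "b \<in> {0..4}" "c \<in> {0..4}" "d \<in> {0..4}" for a b c d
  proof
    assume eq: "G a b = G c d"
    have "b = d"
    proof (rule ccontr)
      assume "b \<noteq> d"
      moreover have "b - d \<in> {-4, -3, -2, -1, 0, 1, 2, 3, 4}" using that by auto
      \<comment> \<open>By Fermat, \<open>(b - d) ^ 3\<close> inverts \<open>b - d\<close> modulo 5,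
        so the equation would put \<open>l\<close> into the prime field.\<close>
      ultimately have "(b - d) ^ 4 mod 5 = 1" by (elim insertE) auto
      then have "l = of_int ((b - d) ^ 4) * l" by (subst mod) simp
      also have "\<dots> = of_int ((b - d) ^ 3) * (of_int (b - d) * l)"
        by (simp add: numeral_3_eq_3 numeral_eq_Suc mult_ac)
      also have "of_int (b - d) * l = of_int (c - a)"
        using eq by (simp add: G_def algebra_simps)
      finally have "l = of_int ((b - d) ^ 3 * (c - a) mod 5)"
        by (metis mod of_int_mult)
      moreover have "(b - d) ^ 3 * (c - a) mod 5 \<in> {0, 1, 2, 3, 4}"
        by (simp; presburger)
      ultimately show False using l by auto
    qed
    then have "(of_int (a - c) :: 'a) = 0" using eq by (simp add: G_def)
    moreover have "a - c \<in> {-4, -3, -2, -1, 0, 1, 2, 3, 4}" using that by auto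
    moreover have "(3 :: 'a) \<noteq> 0"
    proof
      assume "(3 :: 'a) = 0"
      moreover have "(5 :: 'a) = 3 + 2" by simp
      ultimately show False using five two by (simp only:) simp
    qed
    moreover have "(4 :: 'a) = 2 * 2" by simp
    then have "(4 :: 'a) \<noteq> 0" using two by (metis mult_eq_0_iff)
    ultimately have "a = c" using two by (elim insertE) auto
    then show "a = c \<and> b = d" using \<open>b = d\<close> by simp
  qed auto
  have step: "l * (G c b - G a b) = G a d - G a b" if "(c - a) mod 5 = (d - b) mod 5" for a b c d
  proof -
    have "(of_int (c - a) :: 'a) = of_int (d - b)" using that mod by metis
    then show ?thesis by (simp add: G_def algebra_simps flip: distrib_left)
  qed
  have l01: "l \<noteq> 0" "l \<noteq> 1" using l by auto
  show ?thesis
  proof (rule ex_of_trade[OF _ l01])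
    show "card (UNIV :: 'a set) > 4" using q by simp
    let ?T = "[(G 0 0, G 3 0, G 0 3), (G 0 3, G 2 3, G 0 0), (G 2 1, G 4 1, G 2 3),
      (G 2 3, G 3 3, G 2 4), (G 2 4, G 4 4, G 2 1), (G 3 0, G 0 0, G 3 2), (G 3 2, G 4 2, G 3 3),
      (G 3 3, G 0 3, G 3 0), (G 4 1, G 2 1, G 4 4), (G 4 2, G 3 2, G 4 1), (G 4 4, G 2 4, G 4 2)]"
    show "distinct (map fst ?T)" by (simp add: G_eq)
    show "set (map (\<lambda>(x, y, z). y) ?T) = set (map fst ?T)" by auto
    show "set (map (\<lambda>(x, y, z). z) ?T) = set (map fst ?T)" by auto
    show "\<forall>(x, y, z)\<in>set ?T. l * (y - x) = z - x" by (simp add: step)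
    show "(2 :: 'a) \<noteq> 0 \<or> (\<Sum>(x, y, z)\<leftarrow>?T. (y - x) * x) = 0" using two ..
    \<comment> \<open>No \<open>l ^ 2\<close> term remains, because the displacements add up to 0 in
      each row of fixed second coordinate.\<close>
    have "(\<Sum>(x, y, z)\<leftarrow>?T. (y - x) * x ^ 2) = of_int (- 105) + of_int (- 86) * l"
      by (simp add: G_def algebra_simps power2_eq_square)
    also have "\<dots> = 2 * 2 * l" by (subst (1 2) mod) simp
    finally show "(\<Sum>(x, y, z)\<leftarrow>?T. (y - x) * x ^ 2) \<noteq> 0" using two l01 by (simp only: mult_eq_0_iff) simp
  qed
qed

section \<open>Nonlinear base maps in odd characteristic\<close>

text \<open>If \<open>a * x = b * y\<close>, taking \<open>m\<close>-th powers gives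
  \<open>x ^ m = y ^ m\<close>, so the images of the two classes are disjoint.\<close>

lemma inj_two_classes:
  fixes a b :: "'a :: field"
  assumes "a \<noteq> 0" "a ^ m = b ^ m" "m > 0"
  shows "inj (\<lambda>x. if x ^ m = 1 then a * x else b * x)"
proof -
  have b: "b \<noteq> 0" using assms by (metis power_eq_0_iff zero_power)
  have *: "y ^ m = 1" if "x ^ m = 1" "a * x = b * y" for x y
  proof -
    have "a ^ m * x ^ m = b ^ m * y ^ m" using that(2) by (metis power_mult_distrib)
    then show ?thesis using assms b that by simp
  qed
  show ?thesis
    by (rule injI) (use * assms(1) b in \<open>auto split: if_splits; metis\<close>)
qed

text \<open>The square of \<open>x ^ m\<close> is 1. This power is the quadratic character, through
  which squares and nonsquares are expressed below.\<close>

lemma power_half_card: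
  fixes x :: "'a :: finite_field"
  assumes "card (UNIV :: 'a set) = 2 * m + 1" "x \<noteq> 0"
  shows "x ^ m = 1 \<or> x ^ m = - 1"
  using power_card_minus_one[OF assms(2)] assms(1)
  by (simp add: power_mult mult.commute[of 2 m] power2_eq_1_iff)

lemma ex_power_half_card:
  assumes q: "card (UNIV :: 'a :: finite_field set) = 2 * m + 1" and m: "m > 0"
  shows "\<exists>x :: 'a. x ^ m = - 1"
proof -
  obtain x :: 'a where "x \<noteq> 0" "x ^ m \<noteq> 1" using ex_power_neq_1[of m, where 'a='a] q m by auto
  then show ?thesis using power_half_card[OF q] by blast
qed

lemma two_neq_0:
  assumes "odd (card (UNIV :: 'a :: finite_field set))"
  shows "(2 :: 'a) \<noteq> 0"
proof
  assume "(2 :: 'a) = 0"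
  then have "CHAR('a) dvd 2" using of_nat_eq_0_iff_char_dvd[of 2, where 'a='a] by simp
  then have "CHAR('a) = 2" using CHAR_prime[where 'a='a] by (simp add: primes_dvd_imp_eq)
  then show False using assms CHAR_dvd_CARD[where 'a='a] by simp
qed

text \<open>Otherwise \<open>a \<mapsto> 1 - a\<close> injects the nonsquares into the nonzero
  squares. Negation swaps these classes for odd \<open>m\<close>, so their sizes agree and the map
  is onto; but only 0 is sent to 1.\<close>

lemma ex_nonresidue_pair:
  assumes q: "card (UNIV :: 'a :: finite_field set) = 2 * m + 1" and m: "odd m"
  shows "\<exists>a :: 'a. a ^ m = - 1 \<and> (1 - a) ^ m = - 1"
proof (rule ccontr)
  assume none: "\<not> ?thesis"
  have two: "(2 :: 'a) \<noteq> 0" using q by (intro two_neq_0) simp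
  then have neq: "(1 :: 'a) \<noteq> - 1" by (simp add: eq_neg_iff_add_eq_0)
  have m0: "m > 0" using m by (cases m) auto
  define N S where "N = {x :: 'a. x ^ m = - 1}" and "S = {x :: 'a. x ^ m = 1}"
  have "bij_betw uminus N S"
    by (rule bij_betwI[of _ _ _ uminus]) (use m in \<open>auto simp: N_def S_def\<close>)
  then have card: "card N = card S" by (rule bij_betw_same_card)
  have "(\<lambda>a. 1 - a) ` N \<subseteq> S"
  proof
    fix y assume "y \<in> (\<lambda>a. 1 - a) ` N"
    then obtain a where a: "a ^ m = - 1" "y = 1 - a" by (auto simp: N_def)
    then have "a \<noteq> 1" using neq by auto
    then show "y \<in> S" using power_half_card[OF q, of y] none a by (auto simp: S_def)
  qed
  moreover have "card ((\<lambda>a. 1 - a) ` N) = card S"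
    by (subst card_image) (auto simp: inj_on_def card)
  ultimately have "(\<lambda>a. 1 - a) ` N = S" by (intro card_subset_eq) auto
  moreover have "1 \<in> S" by (simp add: S_def)
  ultimately have "0 \<in> N" by (metis (no_types, lifting) diff_self diff_diff_eq2 add_diff_cancel_left' imageE)
  then show False using m0 by (simp add: N_def zero_power)
qed

text \<open>For \<open>b = 1 / (1 - a)\<close>, both \<open>a\<close> and \<open>b\<close> are
  nonsquares while \<open>a - 1\<close> and \<open>b - 1\<close> are squares, so \<open>f\<close> is
  an orthomorphism. This \<open>b\<close> also gives \<open>f (1 - a) = 1\<close>, which makes the
  change at three points possible.\<close>

lemma ex_of_nonresidue_pair:
  assumes q: "card (UNIV :: 'a :: finite_field set) = 2 * m + 1" "m > 1" and m: "odd m"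
  shows "\<exists>p :: 'a poly. orthomorphism_polynomial p \<and> degree p = card (UNIV :: 'a set) - 3"
proof -
  have two: "(2 :: 'a) \<noteq> 0" using q by (intro two_neq_0) simp
  obtain a :: 'a where a: "a ^ m = - 1" "(1 - a) ^ m = - 1"
    using ex_nonresidue_pair q m by blast
  then have a01: "a \<noteq> 0" "a \<noteq> 1" using q by (auto simp: zero_power)
  define b where "b = 1 / (1 - a)"
  define f where "f x = (if x ^ m = 1 then a * x else b * x)" for x
  have b: "b ^ m = - 1" "b - 1 = a / (1 - a)" using a a01 by (auto simp: b_def power_divide field_simps)
  have "a - 1 = - (1 - a)" by simp
  then have a1: "(a - 1) ^ m = 1" using a m by (metis minus_minus power_minus_odd)
  have b1: "(b - 1) ^ m = 1" using a by (simp add: b power_divide)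
  have inj: "inj f" unfolding f_def
    using a01 a b q by (intro inj_two_classes) auto
  have "inj (\<lambda>x. if x ^ m = 1 then (a - 1) * x else (b - 1) * x)"
    using a01 a1 b1 q by (intro inj_two_classes) auto
  also have "(\<lambda>x. if x ^ m = 1 then (a - 1) * x else (b - 1) * x) = (\<lambda>x. f x - x)"
    by (auto simp: f_def algebra_simps)
  finally have inj': "inj (\<lambda>x. f x - x)" .
  have vals: "f 0 = 0" "f 1 = a" "f (1 - a) = 1"
    using a two a01 by (auto simp: f_def b_def eq_neg_iff_add_eq_0)
  \<comment> \<open>Both \<open>f\<close> and \<open>\<lambda>x. f x - x\<close> take their values at \<open>0\<close>, \<open>1\<close> and \<open>1 - a\<close> in a new order, in
    opposite cyclic directions.\<close>
  define \<tau> where "\<tau> = (\<lambda>x. x)(0 := 1, 1 := 1 - a, 1 - a := 0)"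
  define \<tau>' where "\<tau>' = (\<lambda>x. x)(0 := 1 - a, 1 := 0, 1 - a := 1)"
  define f' where "f' = f(0 := a, 1 := 1, 1 - a := 0)"
  have "inj \<tau>" "inj \<tau>'" using a01 by (auto simp: \<tau>_def \<tau>'_def inj_def)
  moreover have "f' = f \<circ> \<tau>" "(\<lambda>x. f' x - x) = (\<lambda>x. f x - x) \<circ> \<tau>'"
    using a01 vals by (auto simp: f'_def \<tau>_def \<tau>'_def fun_eq_iff)
  ultimately have "inj f'" "inj (\<lambda>x. f' x - x)"
    using inj inj' inj_compose by metis+
  then have orth: "orthomorphism f" "orthomorphism f'"
    using inj inj' by (auto simp: orthomorphism_def bij_finite_iff_inj)
  \<comment> \<open>The two sums differ by \<open>a * (1 - a) \<noteq> 0\<close>, so at least one of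
    \<open>f\<close> and \<open>f'\<close> has a nonzero sum.\<close>
  have "(\<Sum>x\<in>UNIV. f' x * x ^ 2) - (\<Sum>x\<in>UNIV. f x * x ^ 2) = (\<Sum>x\<in>UNIV. (f' x - f x) * x ^ 2)"
    by (simp add: sum_subtractf algebra_simps)
  also have "\<dots> = (\<Sum>x\<in>{0, 1, 1 - a}. (f' x - f x) * x ^ 2)"
    by (rule sum.mono_neutral_right) (auto simp: f'_def)
  also have "\<dots> = a * (1 - a)"
    using a01 vals by (simp add: f'_def algebra_simps power2_eq_square)
  finally have "(\<Sum>x\<in>UNIV. f' x * x ^ 2) \<noteq> 0 \<or> (\<Sum>x\<in>UNIV. f x * x ^ 2) \<noteq> 0"
    using a01 by auto
  then show ?thesis
  proof
    assume "(\<Sum>x\<in>UNIV. f' x * x ^ 2) \<noteq> 0"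
    then show ?thesis
      using q by (intro ex_orthomorphism_polynomial[OF orth(2)] sum_mult_orthomorphism[OF orth(2)] two) auto
  next
    assume "(\<Sum>x\<in>UNIV. f x * x ^ 2) \<noteq> 0"
    then show ?thesis
      using q by (intro ex_orthomorphism_polynomial[OF orth(1)] sum_mult_orthomorphism[OF orth(1)] two) auto
  qed
qed

section \<open>Fields of order at most eight\<close>

lemma CHAR_eq_of_card:
  assumes "card (UNIV :: 'a :: finite_field set) = p ^ k" "prime p"
  shows "CHAR('a) = p"
  using CHAR_dvd_CARD[where 'a='a] assms CHAR_prime[where 'a='a]
  by (metis prime_dvd_power primes_dvd_imp_eq)

lemma not_orthomorphism_card_8:
  fixes f :: "'a :: finite_field \<Rightarrow> 'a"
  assumes q: "card (UNIV :: 'a set) = 8" and two: "(2 :: 'a) = 0"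
    and f: "\<And>x. f x = x ^ 5 + b3 * x ^ 3 + b2 * x ^ 2 + b1 * x"
  shows "\<not> orthomorphism f"
proof
  assume orth: "orthomorphism f"
  note dbl = char_2_simps(1)[OF two]
  note dbl' = char_2_simps(2)[OF two]
  note neg = char_2_simps(3)[OF two]
  note dif = char_2_simps(4)[OF two]
  have "(3 :: 'a) = 2 + 1" by simp
  then have three: "(3 :: 'a) = 1" using two by simp
  note sq_add = char_2_simps(5)[OF two]
  have sq_inj: "x ^ 2 = y ^ 2 \<Longrightarrow> x = y" for x y :: 'a by (auto simp: power2_eq_iff neg)
  have p8: "x ^ 8 = x" for x :: 'a using finite_field_power_card_eq_same[of x] q by simp
  define S where "S k = (\<Sum>x\<in>UNIV. x ^ k :: 'a)" for k
  have S_small: "S k = 0" if "k < 7" for k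
    using sum_power_eq_0[of k, where 'a='a] that q by (simp add: S_def)
  have S7: "S 7 = 1"
    using sum_power_card_minus_one[where 'a='a] q by (simp add: S_def neg)
  \<comment> \<open>Positive exponents matter only modulo 7, so among them just the multiples of 7
    give nonzero sums.\<close>
  have S_add: "S (k + 8) = S (k + 1)" for k by (simp add: S_def power_add p8 mult.commute)
  have S: "S 3 = 0" "S 4 = 0" "S 5 = 0" "S 6 = 0" "S 8 = 0" "S 9 = 0" "S 11 = 0" "S 12 = 0" "S 13 = 0" "S 15 = 0"
    using S_small S_add[of 0] S_add[of 1] S_add[of 3] S_add[of 4] S_add[of 5] S_add[of 7] by simp_all
  have f2: "f x ^ 2 = x ^ 10 + b3 ^ 2 * x ^ 6 + b2 ^ 2 * x ^ 4 + b1 ^ 2 * x ^ 2" for x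
    by (simp add: f sq_add power_mult_distrib flip: power_mult)
  have f2x: "f x ^ 2 * x = x ^ 11 + b3 ^ 2 * x ^ 7 + b2 ^ 2 * x ^ 5 + b1 ^ 2 * x ^ 3" for x
    unfolding f2 by (simp add: distrib_right mult.assoc flip: power_Suc2)
  have fx2: "f x * x ^ 2 = x ^ 7 + b3 * x ^ 5 + b2 * x ^ 4 + b1 * x ^ 3" for x
    unfolding f by (simp add: algebra_simps power_numeral_reduce)
  have f3: "(\<Sum>x\<in>UNIV. f x ^ 3) = 0"
    using sum_bij[of f "\<lambda>x. x ^ 3"] orth S(1) by (simp add: orthomorphism_def S_def)
  have "0 = (\<Sum>x\<in>UNIV. (f x - x) ^ 3)"
    using sum_bij[of "\<lambda>x. f x - x" "\<lambda>x. x ^ 3"] orth S(1) by (simp add: orthomorphism_def S_def)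
  also have "\<dots> = (\<Sum>x\<in>UNIV. f x ^ 3 + f x ^ 2 * x + f x * x ^ 2 + x ^ 3)"
    by (intro sum.cong) (simp_all add: dif power3_eq_cube power2_eq_square algebra_simps three)
  also have "\<dots> = (\<Sum>x\<in>UNIV. f x ^ 2 * x + f x * x ^ 2)"
    using f3 S(1) by (simp add: sum.distrib S_def)
  also have "\<dots> = (\<Sum>x\<in>UNIV. (x ^ 11 + b3 ^ 2 * x ^ 7 + b2 ^ 2 * x ^ 5 + b1 ^ 2 * x ^ 3) +
      (x ^ 7 + b3 * x ^ 5 + b2 * x ^ 4 + b1 * x ^ 3))"
    by (simp only: f2x fx2)
  also have "\<dots> = S 11 + b3 ^ 2 * S 7 + b2 ^ 2 * S 5 + b1 ^ 2 * S 3 + (S 7 + b3 * S 5 + b2 * S 4 + b1 * S 3)"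
    by (simp add: S_def sum.distrib flip: sum_distrib_left)
  finally have "b3 ^ 2 + 1 = 0" by (simp add: S S7)
  then have "b3 ^ 2 = 1 ^ 2" by (simp add: add_eq_0_iff2 neg)
  then have b3: "b3 = 1" by (rule sq_inj)
  have "0 = (\<Sum>x\<in>UNIV. f x ^ 2 * f x)"
    using f3 by (simp add: power3_eq_cube power2_eq_square)
  also have "\<dots> = (\<Sum>x\<in>UNIV. x ^ 15 + x ^ 13 + b2 * x ^ 12 + b1 * x ^ 11 +
      (x ^ 11 + x ^ 9 + b2 * x ^ 8 + b1 * x ^ 7) +
      b2 ^ 2 * (x ^ 9 + x ^ 7 + b2 * x ^ 6 + b1 * x ^ 5) +
      b1 ^ 2 * (x ^ 7 + x ^ 5 + b2 * x ^ 4 + b1 * x ^ 3))"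
    unfolding f2 b3 by (intro sum.cong refl) (unfold f b3, simp add: algebra_simps power_numeral_reduce)
  also have "\<dots> = S 15 + S 13 + b2 * S 12 + b1 * S 11 + (S 11 + S 9 + b2 * S 8 + b1 * S 7) +
      b2 ^ 2 * (S 9 + S 7 + b2 * S 6 + b1 * S 5) + b1 ^ 2 * (S 7 + S 5 + b2 * S 4 + b1 * S 3)"
    by (simp add: S_def sum.distrib flip: sum_distrib_left)
  finally have "b2 ^ 2 = b1 + b1 ^ 2"
    by (simp add: S S7) (metis dbl' add.commute add.right_neutral)
  \<comment> \<open>In the field of order 8 the fourth power is the square root.\<close>
  also have "\<dots> = (b1 + b1 ^ 4) ^ 2" by (simp add: sq_add p8 add.commute flip: power_mult)
  finally have b2: "b2 = b1 + b1 ^ 4" by (rule sq_inj)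
  have f0: "f 0 = 0" by (simp add: f)
  have f_neq: "f x \<noteq> 0" "f x \<noteq> x" if "x \<noteq> 0" for x
  proof -
    show "f x \<noteq> 0"
      using orth that f0 unfolding orthomorphism_def bij_def inj_def by metis
    show "f x \<noteq> x"
      using orth that f0 unfolding orthomorphism_def bij_def inj_def by (metis diff_self)
  qed
  \<comment> \<open>Thus \<open>c ^ 2\<close> is a zero of \<open>f\<close> if \<open>c = b1\<close>
    and a fixed point if \<open>c = b1 + 1\<close>; the two cubics below lead to these two
    choices.\<close>
  have root: "f (c ^ 2) = (c + b1) * c ^ 2" if "c ^ 3 = c + 1" "b2 = c + c ^ 4" for c
  proof -
    have "f (c ^ 2) = (c ^ 8 + c ^ 4 + b2 * c ^ 2 + b1) * c ^ 2"
      unfolding f b3 by (simp add: algebra_simps power_numeral_reduce)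
    also have "c ^ 8 + c ^ 4 + b2 * c ^ 2 + b1 = c + b1 + c ^ 3 * (c ^ 3 + (c + 1))"
      unfolding that(2) p8 by (simp add: algebra_simps power_numeral_reduce)
    also have "\<dots> = c + b1" by (simp add: that(1) dbl)
    finally show ?thesis .
  qed
  have "f 1 = b2 + b1" by (simp add: f b3 dbl dbl')
  also have "\<dots> = b1 ^ 4" by (simp add: b2 dbl dbl' add.commute add.left_commute)
  finally have b1: "b1 \<noteq> 0" "b1 \<noteq> 1" using f_neq[of 1] by auto
  have b17: "b1 ^ 7 = 1" using power_card_minus_one[OF b1(1)] q by simp
  \<comment> \<open>This is the factorisation of \<open>x ^ 7 + 1\<close> over the prime field, so
    \<open>b1\<close> is a root of one of the cubics.\<close>
  have "(b1 + 1) * ((b1 ^ 3 + b1 + 1) * (b1 ^ 3 + b1 ^ 2 + 1)) = b1 ^ 7 + 1"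
    by (simp add: algebra_simps power_numeral_reduce dbl dbl')
  moreover have "b1 + 1 \<noteq> 0" using b1 by (simp add: add_eq_0_iff2 neg)
  ultimately have "b1 ^ 3 + b1 + 1 = 0 \<or> b1 ^ 3 + b1 ^ 2 + 1 = 0"
    unfolding b17 dbl mult_eq_0_iff by blast
  then show False
  proof
    assume "b1 ^ 3 + b1 + 1 = 0"
    then have "b1 ^ 3 = b1 + 1" by (metis add.assoc add_eq_0_iff neg)
    then have "f (b1 ^ 2) = 0" using root[of b1] b2 by (simp add: dbl)
    then show False using f_neq b1 by simp
  next
    assume *: "b1 ^ 3 + b1 ^ 2 + 1 = 0"
    \<comment> \<open>Adding 1 exchanges the two cubics and leaves \<open>b1 + b1 ^ 4\<close>
      unchanged.\<close>
    define c where "c = b1 + 1"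
    have "b1 ^ 3 = b1 ^ 2 + 1" using * by (metis add.assoc add_eq_0_iff neg)
    then have "c ^ 3 = c + 1"
      by (simp add: c_def power3_eq_cube power2_eq_square algebra_simps dbl dbl')
    moreover have "c ^ 4 = b1 ^ 4 + 1"
    proof -
      have "c ^ 4 = (c ^ 2) ^ 2" by (simp flip: power_mult)
      also have "\<dots> = b1 ^ 4 + 1" unfolding c_def sq_add by (simp flip: power_mult)
      finally show ?thesis .
    qed
    ultimately have "c ^ 3 = c + 1 \<and> b2 = c + c ^ 4" by (simp add: b2 c_def add_ac dbl dbl')
    moreover have "c + b1 = 1" by (simp add: c_def add_ac two)
    ultimately have "f (c ^ 2) = c ^ 2" using root[of c] by simp
    moreover have "c \<noteq> 0" using b1 by (auto simp: c_def add_eq_0_iff neg)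
    ultimately show False using f_neq by simp
  qed
qed

lemma no_orthomorphism_polynomial_degree_5:
  fixes f :: "'a :: finite_field poly"
  assumes q: "card (UNIV :: 'a set) = 8" and deg: "degree f = 5"
  shows "\<not> orthomorphism_polynomial f"
proof
  assume "orthomorphism_polynomial f"
  then have orth: "orthomorphism (poly f)" by (simp add: orthomorphism_polynomial_iff)
  have two: "(2 :: 'a) = 0"
    using CHAR_eq_of_card[of 2 3, where 'a='a] q of_nat_CHAR[where 'a='a] by simp
  note dbl = char_2_simps(1)[OF two]
  note dbl' = char_2_simps(2)[OF two]
  note sq_add = char_2_simps(5)[OF two]
  have pow4: "(x + y) ^ 4 = x ^ 4 + y ^ 4" for x y :: 'a
  proof -
    have "(x + y) ^ 4 = ((x + y) ^ 2) ^ 2" by (simp flip: power_mult)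
    also have "\<dots> = x ^ 4 + y ^ 4" unfolding sq_add by (simp flip: power_mult)
    finally show ?thesis .
  qed
  have pow3: "(x + y) ^ 3 = x ^ 3 + y * x ^ 2 + y ^ 2 * x + y ^ 3" for x y :: 'a
  proof -
    have "(x + y) ^ 3 = (x + y) ^ 2 * (x + y)" by (simp add: power_numeral_reduce)
    then show ?thesis by (simp add: sq_add algebra_simps power_numeral_reduce two)
  qed
  have pow5: "(x + y) ^ 5 = x ^ 5 + y * x ^ 4 + y ^ 4 * x + y ^ 5" for x y :: 'a
  proof -
    have "(x + y) ^ 5 = (x + y) ^ 4 * (x + y)" by (simp add: power_numeral_reduce)
    also have "\<dots> = (x ^ 4 + y ^ 4) * (x + y)" by (simp only: pow4)
    also have "\<dots> = x ^ 5 + y * x ^ 4 + y ^ 4 * x + y ^ 5"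
      by (simp add: algebra_simps power_numeral_reduce)
    finally show ?thesis .
  qed
  define A a4 a3 a2 a1 where "A = coeff f 5" and "a4 = coeff f 4" and "a3 = coeff f 3"
    and "a2 = coeff f 2" and "a1 = coeff f 1"
  have f: "poly f x = A * x ^ 5 + a4 * x ^ 4 + a3 * x ^ 3 + a2 * x ^ 2 + a1 * x + coeff f 0" for x
    unfolding poly_altdef deg A_def a4_def a3_def a2_def a1_def
    by (simp add: numeral_eq_Suc add_ac)
  have A: "A \<noteq> 0" using deg by (metis A_def leading_coeff_0_iff degree_0 zero_neq_numeral)
  \<comment> \<open>Since \<open>u * v = 1\<close>, \<open>F x - x\<close> arises from
    \<open>poly f x - x\<close> just as \<open>F\<close> does from \<open>poly f\<close>. The
    leading coefficient becomes \<open>A * v ^ 4 = 1\<close> because \<open>A ^ 8 = A\<close>, and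
    \<open>c\<close> removes the quartic term since 5 = 1 here.\<close>
  define u v c where "u = A ^ 2" and "v = 1 / A ^ 2" and "c = a4 / A"
  have "A ^ 8 = A" using finite_field_power_card_eq_same[of A] q by simp
  then have Av: "u * A * v ^ 5 = 1"
    using A by (simp add: u_def v_def power_divide field_simps flip: power_mult)
       (simp add: power_numeral_reduce)
  have uv: "u * v = 1" "u \<noteq> 0" "v \<noteq> 0" using A by (simp_all add: u_def v_def)
  have c: "A * c + a4 = 0" using A by (simp add: c_def dbl)
  define F where "F x = u * (poly f (v * x + c) - poly f c)" for x
  have inj: "inj (\<lambda>x. u * (g (v * x + c) - g c))" if "inj g" for g :: "'a \<Rightarrow> 'a"
  proof (rule injI)
    fix x y assume "u * (g (v * x + c) - g c) = u * (g (v * y + c) - g c)"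
    then have "g (v * x + c) = g (v * y + c)" using uv by simp
    then have "v * x + c = v * y + c" by (rule injD[OF that])
    then show "x = y" using uv by simp
  qed
  have "F x - x = u * ((poly f (v * x + c) - (v * x + c)) - (poly f c - c))" for x
  proof -
    have "u * ((poly f (v * x + c) - (v * x + c)) - (poly f c - c)) = F x - u * v * x"
      by (simp add: F_def algebra_simps)
    then show ?thesis by (simp add: uv)
  qed
  then have "orthomorphism F"
    using orth inj[of "poly f"] inj[of "\<lambda>x. poly f x - x"]
    by (simp add: orthomorphism_def bij_finite_iff_inj F_def [abs_def])
  moreover have "F x = x ^ 5 + (u * a3 * v ^ 3) * x ^ 3 + (u * (a3 * c + a2) * v ^ 2) * x ^ 2 +
      (u * (A * c ^ 4 + a3 * c ^ 2 + a1) * v) * x" for x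
  proof -
    define y where "y = v * x"
    have "F x = u * A * y ^ 5 + u * (A * c + a4) * y ^ 4 + u * a3 * y ^ 3 + u * (a3 * c + a2) * y ^ 2 +
        u * (A * c ^ 4 + a3 * c ^ 2 + a1) * y"
      unfolding F_def y_def[symmetric] f pow5 pow4 pow3 sq_add by (simp add: algebra_simps)
    also have "u * A * y ^ 5 = x ^ 5"
      by (simp only: y_def power_mult_distrib mult.assoc[symmetric] Av mult_1_left)
    finally show ?thesis by (simp add: c y_def power_mult_distrib mult.assoc)
  qed
  ultimately show False using not_orthomorphism_card_8[OF q two] by blast
qed

text \<open>The values at 0 and \<open>- B / A\<close> agree, which forces \<open>B = 0\<close>;
  then 1 and -1 collide.\<close>

lemma no_permutation_polynomial_degree_2:
  fixes f :: "'a :: finite_field poly"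
  assumes deg: "degree f = 2" and two: "(2 :: 'a) \<noteq> 0"
  shows "\<not> permutation_polynomial f"
proof
  assume "permutation_polynomial f"
  then have inj: "x = y" if "poly f x = poly f y" for x y
    using that by (simp add: permutation_polynomial_def bij_def inj_def)
  define A B where "A = coeff f 2" and "B = coeff f 1"
  have f: "poly f x = A * x ^ 2 + B * x + coeff f 0" for x
    unfolding poly_altdef deg A_def B_def by (simp add: numeral_eq_Suc add_ac)
  have A: "A \<noteq> 0" using deg by (metis A_def leading_coeff_0_iff degree_0 zero_neq_numeral)
  have "- B / A = 0" by (rule inj) (use A in \<open>simp add: f power2_eq_square\<close>)
  then have "B = 0" using A by simp
  then have "(1 :: 'a) = - 1" using inj[of 1 "- 1"] by (simp add: f)
  then show False using two by (simp add: eq_neg_iff_add_eq_0)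
qed

text \<open>The degree \<open>q - 3\<close> is 1 here, so an unmodified linear map with slope
  outside \<open>{0, 1}\<close> suffices.\<close>

lemma ex_of_card_4:
  assumes q: "card (UNIV :: 'a :: finite_field set) = 4"
  shows "\<exists>p :: 'a poly. orthomorphism_polynomial p \<and> degree p = 1"
proof -
  have "card {0, 1 :: 'a} = 2" by simp
  then have "{0, 1 :: 'a} \<noteq> UNIV" using q by (metis numeral_eq_iff semiring_norm(85) num.distinct(1) num.inject(1))
  then obtain a :: 'a where a: "a \<noteq> 0" "a \<noteq> 1" by auto
  have "inj (\<lambda>x. x * a)" "inj (\<lambda>x. x * (a - 1))" using a by (simp_all add: inj_def)
  moreover have "(\<lambda>x. x * (a - 1)) = (\<lambda>x. x * a - x)" by (simp add: right_diff_distrib)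
  moreover have "poly [:0, a:] = (\<lambda>x. x * a)" by (simp add: fun_eq_iff)
  ultimately have "orthomorphism_polynomial [:0, a:]"
    by (simp add: orthomorphism_polynomial_iff orthomorphism_def bij_finite_iff_inj)
  moreover have "degree [:0, a:] = 1" using a by simp
  ultimately show ?thesis by blast
qed

section \<open>Case distinction by the characteristic and by \<open>q\<close> modulo 4\<close>

theorem theorem2:
  fixes q :: nat
  assumes "primepow q"
    and "card (UNIV :: 'a :: finite_field set) = q"
  shows "(\<exists>f :: 'a poly. orthomorphism_polynomial f \<and> int (degree f) = int q - 3)
           \<longleftrightarrow> q \<notin> {2, 3, 5, 8}"
proof
  assume "\<exists>f :: 'a poly. orthomorphism_polynomial f \<and> int (degree f) = int q - 3"
  then obtain f :: "'a poly" where f: "orthomorphism_polynomial f" "int (degree f) = int q - 3"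
    by blast
  then have perm: "permutation_polynomial f" by (simp add: orthomorphism_polynomial_def)
  show "q \<notin> {2, 3, 5, 8}"
  proof
    assume "q \<in> {2, 3, 5, 8}"
    then consider "q = 2" | "q = 3" | "q = 5" | "q = 8" by auto
    then show False
    proof cases
      \<comment> \<open>The integer difference is -1, which is not a degree.\<close>
      case 1
      then show False using f by simp
    next
      case 2
      then have "degree f = 0" using f by simp
      then obtain c where "f = [:c:]" by (rule degree_eq_zeroE)
      then show False using perm injD[of "\<lambda>x :: 'a. c" 0 1] by (simp add: permutation_polynomial_def bij_def)
    next
      case 3
      then show False
        using f perm no_permutation_polynomial_degree_2[of f] two_neq_0[where 'a='a] assms(2) by simp
    next
      case 4
      then show False using f no_orthomorphism_polynomial_degree_5[of f] assms(2) by simp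
    qed
  qed
next
  assume q: "q \<notin> {2, 3, 5, 8}"
  obtain p k where pk: "prime p" "k > 0" "q = p ^ k" using assms(1) by (auto simp: primepow_def)
  then have char: "CHAR('a) = p" using CHAR_eq_of_card assms(2) by blast
  have q1: "q > 1" using one_less_power[of p k] prime_gt_1_nat[of p] pk by simp
  \<comment> \<open>The conjunct \<open>q > 3\<close> allows the passage from natural to integer
    subtraction.\<close>
  have "\<exists>f :: 'a poly. orthomorphism_polynomial f \<and> degree f = q - 3 \<and> q > 3"
  proof (cases "p = 2")
    case True
    then have two: "(2 :: 'a) = 0" using char of_nat_CHAR[where 'a='a] by simp
    consider "k = 1" | "k = 2" | "k = 3" | "k \<ge> 4" using pk by linarith
    then show ?thesis
    proof cases
      case 2
      then show ?thesis using ex_of_card_4[where 'a='a] assms(2) pk True by simp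
    next
      case 4
      then have "(2 :: nat) ^ 4 \<le> 2 ^ k" by (intro power_increasing) auto
      then show ?thesis using ex_of_char_2[where 'a='a] two assms(2) pk True by simp
    qed (use q pk True in auto)
  next
    case False
    then have "p > 2" using prime_ge_2_nat[OF pk(1)] by simp
    then have "odd q" using prime_odd_nat[OF pk(1)] pk by simp
    then obtain m where m: "q = 2 * m + 1" by (elim oddE)
    have two: "(2 :: 'a) \<noteq> 0" using \<open>odd q\<close> assms(2) by (intro two_neq_0) simp
    have m3: "m \<ge> 3"
    proof (rule ccontr)
      assume "\<not> m \<ge> 3"
      then have "m = 0 \<or> m = 1 \<or> m = 2" by auto
      then show False using m q q1 by auto
    qed
    have "\<exists>f :: 'a poly. orthomorphism_polynomial f \<and> degree f = card (UNIV :: 'a set) - 3"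
    proof (cases "odd m")
      case True
      then show ?thesis using ex_of_nonresidue_pair[of m, where 'a='a] m m3 assms(2) by simp
    next
      case False
      then obtain n where n: "m = 2 * n" by blast
      \<comment> \<open>As \<open>m\<close> is even, the power of this \<open>x\<close> to
        \<open>m / 2\<close> is a square root of -1.\<close>
      obtain x :: 'a where "x ^ m = - 1"
        using ex_power_half_card[of m, where 'a='a] m m3 assms(2) by auto
      then have i: "x ^ n * x ^ n = - 1" using n by (simp flip: power_add add: mult_2)
      show ?thesis
      proof (cases "(5 :: 'a) = 0")
        case True
        then show ?thesis using ex_of_char_5[where 'a='a] m m3 assms(2) by simp
      next
        case False
        then show ?thesis using ex_of_sqrt_minus_one[OF _ i two] m m3 assms(2) by simp
      qed
    qed
    then show ?thesis using m m3 assms(2) by auto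
  qed
  then show "\<exists>f :: 'a poly. orthomorphism_polynomial f \<and> int (degree f) = int q - 3"
    by (auto simp: of_nat_diff)
qed

end
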